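(* Let $\mathcal I,\mathcal J$ be ideals on $\omega$ and let $\mathcal F,\mathcal G\subseteq\omega^\omega$. If $\mathcal G$ contains the identity function, then $\mathfrak u(\mathcal I,\mathcal F,\mathcal J,\mathcal G)>|\mathcal F|$ if and only if there exists an ultrafilter $\mathcal U$ on $\omega$ such that $\mathcal I\not\le_{\mathcal F}\mathcal U^*$ and $\mathcal J\le_{\mathcal G}\mathcal U^*$.
   Context: An ideal on $\omega$ is a family of subsets of $\omega$ closed under finite unions and subsets, containing all finite sets and not containing $\omega$. Ultrafilters on $\omega$ contain all cofinite sets; $\mathcal U^*=\{\omega\setminus A:A\in\mathcal U\}$ is the dual ideal. For $\mathcal F\subseteq\omega^\omega$ and ideals $\mathcal I,\mathcal K$ on $\omega$, $\mathcal I\le_{\mathcal F}\mathcal K$ means that there is $f\in\mathcal F$ with $f^{-1}[B]\in\mathcal K$ for every $B\in\mathcal I$. For an ideal $\mathcal K$ on $\omega$ and $\mathcal A\subseteq\mathcal P(\omega)$ let $\mathcal K(\mathcal A)=\{B\subseteq\omega:\exists F\in[\mathcal A]^{<\omega}\ (B\setminus\bigcup F\in\mathcal K)\}$; it is an ideal exactly when $\omega\notin\mathcal K(\mathcal A)$. For a cardinal $\lambda\le\mathfrak c=2^{\aleph_0}$, $\mathcal I\preceq^\lambda_{\mathcal F,\mathcal G}\mathcal J$ means: for each ideal $\mathcal J'$ on $\omega$ with $\mathcal J\le_{\mathcal G}\mathcal J'$ there exists $\mathcal A\subseteq\mathcal P(\omega)$ with $|\mathcal A|<\lambda$ such that $\omega\notin\mathcal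 J'(\mathcal A)$ and $\mathcal I\le_{\mathcal F}\mathcal J'(\mathcal A)$. Finally $$\mathfrak u(\mathcal I,\mathcal F,\mathcal J,\mathcal G)=\min\left(\{\lambda\le\mathfrak c:\mathcal I\preceq^\lambda_{\mathcal F,\mathcal G}\mathcal J\}\cup\{\mathfrak c^+\}\right).$$ *)

theory Defs
  imports Complex_Main
begin

unbundle cardinal_syntax

definition ideal_on_omega :: "nat set set \<Rightarrow> bool" where
  "ideal_on_omega I \<longleftrightarrow>
     (\<forall>A. finite A \<longrightarrow> A \<in> I) \<and>
     (\<forall>A\<in>I. \<forall>B\<in>I. A \<union> B \<in> I) \<and>
     (\<forall>A\<in>I. \<forall>B. B \<subseteq> A \<longrightarrow> B \<in> I) \<and>
     UNIV \<notin> I"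

definition ultrafilter_on_omega :: "nat set set \<Rightarrow> bool" where
  "ultrafilter_on_omega U \<longleftrightarrow>
     (\<forall>A. finite (- A) \<longrightarrow> A \<in> U) \<and>
     (\<forall>A\<in>U. \<forall>B\<in>U. A \<inter> B \<in> U) \<and>
     (\<forall>A\<in>U. \<forall>B. A \<subseteq> B \<longrightarrow> B \<in> U) \<and>
     {} \<notin> U \<and>
     (\<forall>A. A \<in> U \<or> - A \<in> U)"

definition dual_ideal :: "nat set set \<Rightarrow> nat set set" where
  "dual_ideal U = {- A | A. A \<in> U}"

definition ideal_le :: "nat set set \<Rightarrow> (nat \<Rightarrow> nat) set \<Rightarrow> nat set set \<Rightarrow> bool" where
  "ideal_le I F K \<longleftrightarrow> (\<exists>f\<in>F. \<forall>B\<in>I. f -` B \<in> K)"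

definition extend_ideal :: "nat set set \<Rightarrow> nat set set \<Rightarrow> nat set set" where
  "extend_ideal K \<A> = {B. \<exists>E. finite E \<and> E \<subseteq> \<A> \<and> B - \<Union>E \<in> K}"

abbreviation continuum :: "nat set rel" where
  "continuum \<equiv> |UNIV :: nat set set|"

text \<open>Cardinals, finite ones included, are represented by cardinal orders, which are compared
  up to isomorphism by \<open>\<le>o\<close> and \<open><o\<close>, also across types.\<close>

definition ideal_prec ::
  "'c rel \<Rightarrow> nat set set \<Rightarrow> (nat \<Rightarrow> nat) set \<Rightarrow> nat set set \<Rightarrow> (nat \<Rightarrow> nat) set \<Rightarrow> bool" where
  "ideal_prec \<nu> I F J G \<longleftrightarrow>
     (\<forall>J'. ideal_on_omega J' \<longrightarrow> ideal_le J G J' \<longrightarrow>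
        (\<exists>\<A> :: nat set set. |\<A>| <o \<nu> \<and> UNIV \<notin> extend_ideal J' \<A> \<and>
           ideal_le I F (extend_ideal J' \<A>)))"

text \<open>The type \<^typ>\<open>nat set set\<close> is large enough to carry every cardinal up to the successor of
  the continuum.  The minimum is determined up to isomorphism of cardinal orders, and
  \<open>SOME\<close> picks a representative.\<close>

definition u_candidates ::
  "nat set set \<Rightarrow> (nat \<Rightarrow> nat) set \<Rightarrow> nat set set \<Rightarrow> (nat \<Rightarrow> nat) set \<Rightarrow> nat set set rel set" where
  "u_candidates I F J G =
     {\<nu>. Card_order \<nu> \<and> \<nu> \<le>o continuum \<and> ideal_prec \<nu> I F J G} \<union> {cardSuc continuum}"

definition u_card ::
  "nat set set \<Rightarrow> (nat \<Rightarrow> nat) set \<Rightarrow> nat set set \<Rightarrow> (nat \<Rightarrow> nat) set \<Rightarrow> nat set set rel" where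
  "u_card I F J G =
     (SOME \<kappa>. \<kappa> \<in> u_candidates I F J G \<and> (\<forall>\<nu>\<in>u_candidates I F J G. \<kappa> \<le>o \<nu>))"

lemma u_card_min:
  "u_card I F J G \<in> u_candidates I F J G"
  "\<nu> \<in> u_candidates I F J G \<Longrightarrow> u_card I F J G \<le>o \<nu>"
proof -
  have "\<forall>r \<in> u_candidates I F J G. Card_order r"
    by (auto simp: u_candidates_def cardSuc_Card_order card_of_Card_order)
  moreover have "u_candidates I F J G \<noteq> {}"
    by (auto simp: u_candidates_def)
  ultimately have "\<exists>\<kappa>. \<kappa> \<in> u_candidates I F J G \<and> (\<forall>\<nu>\<in>u_candidates I F J G. \<kappa> \<le>o \<nu>)"
    using exists_minim_Card_order by blast
  from someI_ex[OF this]
  show "u_card I F J G \<in> u_candidates I F J G"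
    "\<nu> \<in> u_candidates I F J G \<Longrightarrow> u_card I F J G \<le>o \<nu>"
    unfolding u_card_def by auto
qed

lemma ideal_prec_mono:
  assumes "\<nu> \<le>o \<mu>" "ideal_prec \<nu> I F J G"
  shows "ideal_prec \<mu> I F J G"
  unfolding ideal_prec_def
proof (intro allI impI)
  fix J' assume "ideal_on_omega J'" "ideal_le J G J'"
  with assms(2) obtain \<A> :: "nat set set" where \<A>: "|\<A>| <o \<nu>" "UNIV \<notin> extend_ideal J' \<A>"
    "ideal_le I F (extend_ideal J' \<A>)"
    unfolding ideal_prec_def by blast
  from ordLess_ordLeq_trans[OF \<A>(1) assms(1)] \<A>(2,3)
  show "\<exists>\<A> :: nat set set. |\<A>| <o \<mu> \<and> UNIV \<notin> extend_ideal J' \<A> \<and>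
      ideal_le I F (extend_ideal J' \<A>)"
    by blast
qed

lemma u_card_le:
  fixes \<nu> :: "'c rel"
  assumes "Card_order \<nu>" "\<nu> \<le>o continuum" "ideal_prec \<nu> I F J G"
  shows "u_card I F J G \<le>o \<nu>"
proof -
  have "|UNIV :: nat set set| \<le>o |UNIV :: nat set set set|"
    using card_of_Pow[of "UNIV :: nat set set"] ordLess_imp_ordLeq by simp
  then have "\<nu> \<le>o |UNIV :: nat set set set|"
    by (rule ordLeq_transitive[OF assms(2)])
  then obtain \<mu> :: "nat set set rel" where \<mu>: "\<nu> =o \<mu>"
    using internalize_ordLeq[of \<nu> "|UNIV :: nat set set set|"] by blast
  have "Card_order \<mu>"
    using Card_order_ordIso2[OF assms(1) \<mu>] .
  moreover have "\<mu> \<le>o continuum"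
    using ordIso_ordLeq_trans[OF ordIso_symmetric[OF \<mu>] assms(2)] .
  moreover have "ideal_prec \<mu> I F J G"
    using ideal_prec_mono[OF ordIso_imp_ordLeq[OF \<mu>] assms(3)] .
  ultimately have "\<mu> \<in> u_candidates I F J G"
    unfolding u_candidates_def by simp
  from ordLeq_ordIso_trans[OF u_card_min(2)[OF this] ordIso_symmetric[OF \<mu>]]
  show ?thesis .
qed

end

theory Submission
  imports Defs "HOL-Library.Nat_Bijection"
begin

text \<open>
  Suppose first that \<open>U\<close> is an ultrafilter with \<open>J \<le>\<^sub>G U\<^sup>*\<close> and \<open>I \<not>\<le>\<^sub>F U\<^sup>*\<close>. The ideal \<open>U\<^sup>*\<close> is
  maximal, so a proper ideal of the form \<open>U\<^sup>*(\<A>)\<close> is \<open>U\<^sup>*\<close> itself, however large \<open>\<A>\<close> is. Hence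
  \<open>J' = U\<^sup>*\<close> refutes the defining relation of the invariant for every cardinal, and the invariant is
  the successor of the continuum, which exceeds \<open>|F|\<close>.

  Conversely, if the invariant exceeds \<open>|F|\<close>, then the relation fails for the cardinal \<open>|F|\<close>, which
  is at most the continuum. So there is an ideal \<open>J'\<close> with \<open>J \<le>\<^sub>G J'\<close> such that no proper ideal
  \<open>J'(\<A>)\<close> with \<open>|\<A>| < |F|\<close> satisfies \<open>I \<le>\<^sub>F J'(\<A>)\<close>. Well-order \<open>F\<close> in type \<open>|F|\<close> and choose by
  transfinite recursion, for each \<open>f\<close>, a set \<open>B\<^sub>f \<in> I\<close> such that the preimage of \<open>B\<^sub>f\<close> under \<open>f\<close> is
  not in the ideal generated by \<open>J'\<close> and the complements of the preimages chosen earlier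
  (\<open>diagonal_choice\<close>). Fewer than \<open>|F|\<close> sets were added before stage \<open>f\<close>, and properness is never
  lost, since a failure involves only finitely many of these complements and the last of them could
  not have been added (\<open>proper_extend_ideal_if_independent\<close>). A maximal ideal containing \<open>J'\<close> and all
  the complements (\<open>ideal_on_omega_imp_maximal\<close>) is the dual of the required ultrafilter: for every
  \<open>f \<in> F\<close> it omits the preimage of \<open>B\<^sub>f\<close>.
\<close>

section \<open>Ideals generated over an ideal\<close>

lemma ideal_on_omega_subset:
  "ideal_on_omega K \<Longrightarrow> A \<in> K \<Longrightarrow> B \<subseteq> A \<Longrightarrow> B \<in> K"
  unfolding ideal_on_omega_def by blast

lemma ideal_on_omega_Un:
  "ideal_on_omega K \<Longrightarrow> A \<in> K \<Longrightarrow> B \<in> K \<Longrightarrow> A \<union> B \<in> K"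
  unfolding ideal_on_omega_def by blast

lemma ideal_on_omega_finite: "ideal_on_omega K \<Longrightarrow> finite A \<Longrightarrow> A \<in> K"
  unfolding ideal_on_omega_def by blast

lemma UNIV_notin_ideal_on_omega: "ideal_on_omega K \<Longrightarrow> UNIV \<notin> K"
  unfolding ideal_on_omega_def by blast

lemma extend_idealI: "finite E \<Longrightarrow> E \<subseteq> \<A> \<Longrightarrow> B - \<Union>E \<in> K \<Longrightarrow> B \<in> extend_ideal K \<A>"
  unfolding extend_ideal_def by blast

lemma extend_idealE:
  assumes "B \<in> extend_ideal K \<A>"
  obtains E where "finite E" "E \<subseteq> \<A>" "B - \<Union>E \<in> K"
  using assms unfolding extend_ideal_def by blast

lemma subset_extend_ideal: "K \<subseteq> extend_ideal K \<A>"
  by (auto intro: extend_idealI[where E = "{}"])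

lemma generators_subset_extend_ideal:
  assumes "ideal_on_omega K"
  shows "\<A> \<subseteq> extend_ideal K \<A>"
proof
  fix A assume "A \<in> \<A>"
  then show "A \<in> extend_ideal K \<A>"
    using ideal_on_omega_finite[OF assms] by (intro extend_idealI[where E = "{A}"]) auto
qed

lemma ideal_on_omega_extend_ideal:
  assumes K: "ideal_on_omega K" and proper: "UNIV \<notin> extend_ideal K \<A>"
  shows "ideal_on_omega (extend_ideal K \<A>)"
  unfolding ideal_on_omega_def
proof (intro conjI allI ballI impI)
  show "A \<in> extend_ideal K \<A>" if "finite A" for A
    using ideal_on_omega_finite[OF K that] subset_extend_ideal by blast
  show "A \<union> B \<in> extend_ideal K \<A>" if A: "A \<in> extend_ideal K \<A>" and B: "B \<in> extend_ideal K \<A>" for A B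
  proof -
    obtain D where D: "finite D" "D \<subseteq> \<A>" "A - \<Union>D \<in> K"
      using A by (rule extend_idealE)
    obtain E where E: "finite E" "E \<subseteq> \<A>" "B - \<Union>E \<in> K"
      using B by (rule extend_idealE)
    have "A \<union> B - \<Union>(D \<union> E) \<in> K"
      by (rule ideal_on_omega_subset[OF K ideal_on_omega_Un[OF K D(3) E(3)]]) auto
    then show ?thesis
      using D E by (intro extend_idealI[where E = "D \<union> E"]) auto
  qed
  show "B \<in> extend_ideal K \<A>" if A: "A \<in> extend_ideal K \<A>" and "B \<subseteq> A" for A B
  proof -
    obtain E where E: "finite E" "E \<subseteq> \<A>" "A - \<Union>E \<in> K"
      using A by (rule extend_idealE)
    have "B - \<Union>E \<in> K"
      by (rule ideal_on_omega_subset[OF K E(3)]) (use \<open>B \<subseteq> A\<close> in auto)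
    then show ?thesis
      using E by (intro extend_idealI)
  qed
  show "UNIV \<notin> extend_ideal K \<A>"
    by (rule proper)
qed

section \<open>Maximal ideals and ultrafilters\<close>

lemma ideal_on_omega_imp_maximal:
  assumes K: "ideal_on_omega K"
  obtains M where "ideal_on_omega M" "K \<subseteq> M" "\<And>A. A \<in> M \<or> - A \<in> M"
proof -
  let ?S = "{L. ideal_on_omega L \<and> K \<subseteq> L}"
  have Union: "\<Union>C \<in> ?S" if "C \<noteq> {}" and chain: "subset.chain ?S C" for C
  proof -
    have C: "ideal_on_omega L" "K \<subseteq> L" if "L \<in> C" for L
      using that chain unfolding subset_chain_def by auto
    obtain L where "L \<in> C"
      using \<open>C \<noteq> {}\<close> by blast
    have "A \<union> B \<in> \<Union>C" if A: "A \<in> \<Union>C" and B: "B \<in> \<Union>C" for A B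
    proof -
      obtain L L' where L: "L \<in> C" "A \<in> L" "L' \<in> C" "B \<in> L'"
        using A B by blast
      then have "L \<subseteq> L' \<or> L' \<subseteq> L"
        using chain unfolding subset_chain_def by blast
      then show ?thesis
        using L C(1) ideal_on_omega_Un by (metis UnionI subsetD)
    qed
    moreover have "A \<in> \<Union>C" if "finite A" for A
      using ideal_on_omega_finite[OF C(1)] that \<open>L \<in> C\<close> by blast
    moreover have "B \<in> \<Union>C" if "A \<in> \<Union>C" "B \<subseteq> A" for A B
      using ideal_on_omega_subset[OF C(1)] that by blast
    moreover have "UNIV \<notin> \<Union>C"
      using UNIV_notin_ideal_on_omega[OF C(1)] by blast
    ultimately have "ideal_on_omega (\<Union>C)"
      unfolding ideal_on_omega_def[of "\<Union>C"] by simp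
    then show ?thesis
      using C(2) \<open>L \<in> C\<close> by blast
  qed
  have "?S \<noteq> {}"
    using K by blast
  from subset_Zorn_nonempty[OF this Union] obtain M where M: "ideal_on_omega M" "K \<subseteq> M"
    and maximal: "\<And>L. ideal_on_omega L \<Longrightarrow> M \<subseteq> L \<Longrightarrow> L = M"
    by auto
  have "A \<in> M \<or> - A \<in> M" for A
  proof (rule ccontr)
    assume A: "\<not> (A \<in> M \<or> - A \<in> M)"
    have "UNIV \<notin> extend_ideal M {A}"
    proof
      assume "UNIV \<in> extend_ideal M {A}"
      then obtain E where E: "E \<subseteq> {A}" "UNIV - \<Union>E \<in> M"
        by (rule extend_idealE)
      have "- A \<in> M"
        by (rule ideal_on_omega_subset[OF M(1) E(2)]) (use E(1) in auto)
      then show False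
        using A by blast
    qed
    then have "extend_ideal M {A} = M"
      using maximal ideal_on_omega_extend_ideal[OF M(1)] subset_extend_ideal by blast
    then show False
      using A generators_subset_extend_ideal[OF M(1), of "{A}"] by blast
  qed
  then show ?thesis
    using that M by blast
qed

lemma mem_dual_ideal_iff: "A \<in> dual_ideal U \<longleftrightarrow> - A \<in> U"
  unfolding dual_ideal_def by (auto intro: exI[where x = "- A"])

lemma ideal_on_omega_dual_ideal:
  assumes "ultrafilter_on_omega U"
  shows "ideal_on_omega (dual_ideal U)"
  unfolding ideal_on_omega_def mem_dual_ideal_iff
proof (intro conjI allI ballI impI)
  show "- A \<in> U" if "finite A" for A
    using assms that by (simp add: ultrafilter_on_omega_def)
  show "- (A \<union> B) \<in> U" if "A \<in> dual_ideal U" "B \<in> dual_ideal U" for A B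
    using assms that by (simp add: ultrafilter_on_omega_def mem_dual_ideal_iff)
  show "- B \<in> U" if "A \<in> dual_ideal U" "B \<subseteq> A" for A B
    using assms that Compl_anti_mono[of B A]
    unfolding ultrafilter_on_omega_def mem_dual_ideal_iff by blast
  show "- UNIV \<notin> U"
    using assms by (simp add: ultrafilter_on_omega_def)
qed

lemma maximal_ideal_is_dual_ideal:
  assumes M: "ideal_on_omega M" and maximal: "\<And>A. A \<in> M \<or> - A \<in> M"
  obtains U where "ultrafilter_on_omega U" "dual_ideal U = M"
proof
  let ?U = "{A. - A \<in> M}"
  show "ultrafilter_on_omega ?U"
    unfolding ultrafilter_on_omega_def
  proof (intro conjI allI ballI impI)
    show "A \<in> ?U" if "finite (- A)" for A
      using ideal_on_omega_finite[OF M that] by simp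
    show "A \<inter> B \<in> ?U" if "A \<in> ?U" "B \<in> ?U" for A B
      using ideal_on_omega_Un[OF M, of "- A" "- B"] that by simp
    show "B \<in> ?U" if "A \<in> ?U" "A \<subseteq> B" for A B
      using ideal_on_omega_subset[OF M, of "- A" "- B"] that by simp
    show "{} \<notin> ?U"
      using UNIV_notin_ideal_on_omega[OF M] by simp
    show "A \<in> ?U \<or> - A \<in> ?U" for A
      using maximal[of A] by auto
  qed
  show "dual_ideal ?U = M"
    by (auto simp: mem_dual_ideal_iff)
qed

text \<open>Maximality of the dual ideal of an ultrafilter: no proper ideal is generated over it except
  itself.\<close>

lemma extend_dual_ideal_eq:
  assumes U: "ultrafilter_on_omega U" and proper: "UNIV \<notin> extend_ideal (dual_ideal U) \<A>"
  shows "extend_ideal (dual_ideal U) \<A> = dual_ideal U"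
proof
  have ideal: "ideal_on_omega (extend_ideal (dual_ideal U) \<A>)"
    using ideal_on_omega_extend_ideal[OF ideal_on_omega_dual_ideal[OF U] proper] .
  show "extend_ideal (dual_ideal U) \<A> \<subseteq> dual_ideal U"
  proof
    fix B assume B: "B \<in> extend_ideal (dual_ideal U) \<A>"
    show "B \<in> dual_ideal U"
    proof (rule ccontr)
      assume "B \<notin> dual_ideal U"
      then have "- B \<in> dual_ideal U"
        using U by (auto simp: mem_dual_ideal_iff ultrafilter_on_omega_def)
      then have "B \<union> - B \<in> extend_ideal (dual_ideal U) \<A>"
        using B subset_extend_ideal ideal_on_omega_Un[OF ideal] by blast
      then show False
        using proper by simp
    qed
  qed
qed (rule subset_extend_ideal)

section \<open>Diagonalization along a well-order\<close>

lemma finite_Linear_order_has_greatest: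
  assumes r: "Linear_order r" and "finite T" "T \<noteq> {}" "T \<subseteq> Field r"
  shows "\<exists>m\<in>T. \<forall>y\<in>T. (y, m) \<in> r"
  using assms(2-)
proof (induction T rule: finite_ne_induct)
  case (singleton x)
  then show ?case
    using r by (auto simp: order_on_defs refl_on_def)
next
  case (insert x T)
  then obtain m where m: "m \<in> T" "\<forall>y\<in>T. (y, m) \<in> r"
    by blast
  have "x \<in> Field r" "m \<in> Field r"
    using insert.prems m(1) by auto
  then have xx: "(x, x) \<in> r" and "(x, m) \<in> r \<or> (m, x) \<in> r"
    using r unfolding order_on_defs refl_on_def total_on_def by metis+
  then show ?case
  proof (elim disjE)
    assume "(x, m) \<in> r"
    then show ?thesis using m by blast
  next
    assume "(m, x) \<in> r"
    then have "\<forall>y\<in>T. (y, x) \<in> r"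
      using r m(2) unfolding order_on_defs by (blast dest: transD)
    then show ?thesis using xx by blast
  qed
qed

text \<open>If no set \<open>D x\<close> lies in the ideal generated by the complements of its predecessors, then the
  complements of all of these sets generate a proper ideal.\<close>

lemma proper_extend_ideal_if_independent:
  assumes K: "ideal_on_omega K" and r: "Linear_order r" and "S \<subseteq> Field r"
    and indep: "\<And>x. x \<in> S \<Longrightarrow> D x \<notin> extend_ideal K ((\<lambda>y. - D y) ` underS r x)"
  shows "UNIV \<notin> extend_ideal K ((\<lambda>y. - D y) ` S)"
proof
  assume "UNIV \<in> extend_ideal K ((\<lambda>y. - D y) ` S)"
  then obtain E where E: "finite E" "E \<subseteq> (\<lambda>y. - D y) ` S" "UNIV - \<Union>E \<in> K"
    by (rule extend_idealE)
  then obtain T where T: "T \<subseteq> S" "finite T" "E = (\<lambda>y. - D y) ` T"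
    by (meson finite_subset_image)
  have "T \<noteq> {}"
    using E(3) T(3) UNIV_notin_ideal_on_omega[OF K] by auto
  then obtain m where m: "m \<in> T" "\<forall>y\<in>T. (y, m) \<in> r"
    using finite_Linear_order_has_greatest[OF r T(2)] T(1) \<open>S \<subseteq> Field r\<close> by blast
  \<comment> \<open>The complement of \<open>D m\<close> does not meet \<open>D m\<close>, so the remaining generators cover \<open>D m\<close>
    modulo \<open>K\<close>.\<close>
  have "D m - \<Union>((\<lambda>y. - D y) ` (T - {m})) \<in> K"
    by (rule ideal_on_omega_subset[OF K E(3)]) (use T(3) in auto)
  moreover have "(\<lambda>y. - D y) ` (T - {m}) \<subseteq> (\<lambda>y. - D y) ` underS r m"
    using m(2) by (intro image_mono) (auto simp: underS_def)
  ultimately have "D m \<in> extend_ideal K ((\<lambda>y. - D y) ` underS r m)"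
    using T(2) by (intro extend_idealI[where E = "(\<lambda>y. - D y) ` (T - {m})"]) auto
  then show False
    using indep m(1) T(1) by blast
qed

text \<open>If adding fewer than \<open>|F|\<close> generators to \<open>K\<close> never puts \<open>I\<close> below the resulting ideal via \<open>F\<close>,
  then all elements of \<open>F\<close> can be defeated simultaneously.\<close>

lemma diagonal_choice:
  assumes K: "ideal_on_omega K"
    and not_le: "\<And>\<A> :: nat set set. |\<A>| <o |F| \<Longrightarrow> UNIV \<notin> extend_ideal K \<A> \<Longrightarrow>
      \<not> ideal_le I F (extend_ideal K \<A>)"
  obtains B where "\<And>f. f \<in> F \<Longrightarrow> B f \<in> I"
    and "UNIV \<notin> extend_ideal K ((\<lambda>f. - (f -` B f)) ` F)"
proof -
  let ?r = "|F|"
  let ?P = "\<lambda>B f b. f \<in> F \<longrightarrow>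
    b \<in> I \<and> f -` b \<notin> extend_ideal K ((\<lambda>g. - (g -` B g)) ` underS ?r f)"
  have lin: "Linear_order ?r"
    using card_of_Well_order[of F] by (simp add: well_order_on_def)
  have Field: "Field ?r = F"
    by (rule Field_card_of)
  have "\<exists>B. \<forall>f. ?P B f (B f)"
  proof (rule dependent_wf_choice[of "?r - Id"])
    show "wf (?r - Id)"
      using card_of_Well_order[of F] by (simp add: well_order_on_def)
    show "?P B f b = ?P B' f b" if "\<And>g. (g, f) \<in> ?r - Id \<Longrightarrow> B g = B' g" for B B' f b
    proof -
      have "(\<lambda>g. - (g -` B g)) ` underS ?r f = (\<lambda>g. - (g -` B' g)) ` underS ?r f"
        using that by (intro image_cong) (auto simp: underS_def)
      then show ?thesis by simp
    qed
    show "\<exists>b. ?P B f b" if prev: "\<And>g. (g, f) \<in> ?r - Id \<Longrightarrow> ?P B g (B g)" for B f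
    proof (cases "f \<in> F")
      case True
      let ?A = "(\<lambda>g. - (g -` B g)) ` underS ?r f"
      have "underS ?r f \<subseteq> F"
        using Field by (auto simp: underS_def Field_def)
      moreover have "g -` B g \<notin> extend_ideal K ((\<lambda>h. - (h -` B h)) ` underS ?r g)"
        if "g \<in> underS ?r f" for g
        using prev[of g] that \<open>underS ?r f \<subseteq> F\<close> by (auto simp: underS_def)
      ultimately have "UNIV \<notin> extend_ideal K ?A"
        using Field by (intro proper_extend_ideal_if_independent[OF K lin]) auto
      moreover have "|?A| <o |F|"
        by (rule ordLeq_ordLess_trans[OF card_of_image card_of_underS[OF card_of_Card_order]])
          (simp add: True Field)
      ultimately have "\<not> ideal_le I F (extend_ideal K ?A)"
        by (rule not_le[rotated])
      then show ?thesis
        using True unfolding ideal_le_def by blast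
    qed simp
  qed
  then obtain B where B: "\<forall>f. ?P B f (B f)" ..
  show ?thesis
  proof (rule that)
    show "B f \<in> I" if "f \<in> F" for f
      using B that by simp
    show "UNIV \<notin> extend_ideal K ((\<lambda>f. - (f -` B f)) ` F)"
      using B Field by (intro proper_extend_ideal_if_independent[OF K lin]) simp_all
  qed
qed

section \<open>The characterization by ultrafilters\<close>

lemma card_of_functions_le_continuum: "|F :: (nat \<Rightarrow> nat) set| \<le>o continuum"
proof -
  let ?graph = "\<lambda>f :: nat \<Rightarrow> nat. range (\<lambda>n. prod_encode (n, f n))"
  have "inj_on ?graph F"
  proof (intro inj_onI ext)
    fix f g :: "nat \<Rightarrow> nat" and n
    assume "?graph f = ?graph g"
    then have "prod_encode (n, f n) \<in> ?graph g"
      by blast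
    then show "f n = g n"
      by auto
  qed
  then show ?thesis
    using card_of_ordLeq[of F "UNIV :: nat set set"] by blast
qed

lemma not_ideal_prec_if_ultrafilter:
  assumes U: "ultrafilter_on_omega U"
    and "\<not> ideal_le I F (dual_ideal U)" and "ideal_le J G (dual_ideal U)"
  shows "\<not> ideal_prec \<nu> I F J G"
  using assms ideal_on_omega_dual_ideal[OF U] extend_dual_ideal_eq[OF U]
  unfolding ideal_prec_def by metis

lemma ultrafilter_if_not_ideal_prec:
  assumes "\<not> ideal_prec |F| I F J G"
  shows "\<exists>U. ultrafilter_on_omega U \<and> \<not> ideal_le I F (dual_ideal U) \<and> ideal_le J G (dual_ideal U)"
proof -
  from assms obtain K where K: "ideal_on_omega K" "ideal_le J G K"
    and not_le: "\<And>\<A> :: nat set set. |\<A>| <o |F| \<Longrightarrow> UNIV \<notin> extend_ideal K \<A> \<Longrightarrow>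
      \<not> ideal_le I F (extend_ideal K \<A>)"
    unfolding ideal_prec_def by blast
  obtain B where B: "\<And>f. f \<in> F \<Longrightarrow> B f \<in> I"
    and proper: "UNIV \<notin> extend_ideal K ((\<lambda>f. - (f -` B f)) ` F)"
    using diagonal_choice[OF K(1) not_le] by blast
  obtain M where M: "ideal_on_omega M" "extend_ideal K ((\<lambda>f. - (f -` B f)) ` F) \<subseteq> M"
    and maximal: "\<And>A. A \<in> M \<or> - A \<in> M"
    using ideal_on_omega_imp_maximal[OF ideal_on_omega_extend_ideal[OF K(1) proper]] by blast
  obtain U where U: "ultrafilter_on_omega U" "dual_ideal U = M"
    using maximal_ideal_is_dual_ideal[OF M(1) maximal] by blast
  have "f -` B f \<notin> M" if "f \<in> F" for f
  proof
    assume "f -` B f \<in> M"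
    moreover have "- (f -` B f) \<in> M"
      using that M(2) generators_subset_extend_ideal[OF K(1)] by blast
    ultimately have "f -` B f \<union> - (f -` B f) \<in> M"
      by (rule ideal_on_omega_Un[OF M(1)])
    then show False
      using UNIV_notin_ideal_on_omega[OF M(1)] by simp
  qed
  then have "\<not> ideal_le I F M"
    using B unfolding ideal_le_def by blast
  moreover have "ideal_le J G M"
    using K(2) M(2) subset_extend_ideal unfolding ideal_le_def by blast
  ultimately show ?thesis
    using U by blast
qed

theorem theorem3p4:
  fixes I J :: "nat set set" and F G :: "(nat \<Rightarrow> nat) set"
  assumes "ideal_on_omega I" and "ideal_on_omega J"
    and "id \<in> G"
  shows "|F| <o u_card I F J G \<longleftrightarrow>
    (\<exists>U. ultrafilter_on_omega U \<and> \<not> ideal_le I F (dual_ideal U) \<and> ideal_le J G (dual_ideal U))"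
proof
  assume "|F| <o u_card I F J G"
  then have "\<not> ideal_prec |F| I F J G"
    using u_card_le[OF card_of_Card_order card_of_functions_le_continuum] not_ordLess_ordLeq
    by blast
  then show "\<exists>U. ultrafilter_on_omega U \<and> \<not> ideal_le I F (dual_ideal U) \<and> ideal_le J G (dual_ideal U)"
    by (rule ultrafilter_if_not_ideal_prec)
next
  assume "\<exists>U. ultrafilter_on_omega U \<and> \<not> ideal_le I F (dual_ideal U) \<and> ideal_le J G (dual_ideal U)"
  then have "\<not> ideal_prec \<nu> I F J G" for \<nu> :: "nat set set rel"
    using not_ideal_prec_if_ultrafilter by blast
  then have "u_card I F J G = cardSuc continuum"
    using u_card_min(1)[of I F J G] unfolding u_candidates_def by blast
  moreover have "|F| <o cardSuc continuum"
    using card_of_functions_le_continuum cardSuc_greater[OF card_of_Card_order]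
    by (rule ordLeq_ordLess_trans)
  ultimately show "|F| <o u_card I F J G"
    by simp
qed

end
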